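(* Let $p>0$ and $0<\epsilon\le p/3$, and let $a=(a_j)_{j\ge1}\in\mathcal F(\tfrac{2p}{3}+\epsilon;\,p)$. For each $n\ge 1$ let $\sigma_n$ be the unique real solution of $\sum_{l=1}^n l a_l e^{-l\sigma_n}=n$ and let $B_n^2=\sum_{l=1}^n l^2a_le^{-l\sigma_n}$. Then $$c_n\sim\frac{1}{\sqrt{2\pi B_n^2}}\exp\Big(n\sigma_n+\sum_{j=1}^n a_je^{-j\sigma_n}\Big)\quad\text{as } n\to\infty .$$
   Context: For $0<p_1\le p_2$, $\mathcal F(p_1;p_2)$ is the set of sequences $(a_j)_{j\ge1}$ of positive reals such that $\lim_{n\to\infty}a_n/a_{n+1}=1$ and there are constants $\gamma_1,\gamma_2>0$ with $\gamma_1 j^{p_1-1}\le a_j\le\gamma_2 j^{p_2-1}$ for all sufficiently large $j$. For a positive sequence $(a_j)$, $c_n=\sum \frac{a_1^{n_1}a_2^{n_2}\cdots a_n^{n_n}}{n_1!\,n_2!\cdots n_n!}$, the sum being over all tuples $(n_1,\dots,n_n)$ of nonnegative integers with $\sum_{k=1}^n kn_k=n$ (that is, over partitions of $n$ with $n_k$ parts of size $k$); equivalently $\sum_{n\ge0}c_nx^n=\exp\big(\sum_{n\ge1}a_nx^n\big)$ as formal power series, with $c_0=1$. $f(n)\sim g(n)$ means $f(n)/g(n)\to1$. *)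

theory Defs
  imports
    "HOL-Analysis.Analysis"
    "HOL-Library.Landau_Symbols"
begin

text \<open>
  A sequence \<open>(a\<^sub>j)\<close> with \<open>j \<ge> 1\<close> is a function on \<^typ>\<open>nat\<close> whose value at 0 is irrelevant:
  nothing below depends on \<open>a 0\<close>.
\<close>

definition seq_class :: "real \<Rightarrow> real \<Rightarrow> (nat \<Rightarrow> real) set" where
  "seq_class p1 p2 = {a.
     (\<forall>j\<ge>1. 0 < a j) \<and>
     (\<lambda>n. a n / a (n + 1)) \<longlonglongrightarrow> 1 \<and>
     (\<exists>\<gamma>1>0. \<exists>\<gamma>2>0. \<forall>\<^sub>F j in sequentially.
        \<gamma>1 * real j powr (p1 - 1) \<le> a j \<and> a j \<le> \<gamma>2 * real j powr (p2 - 1))}"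

text \<open>
  Tuples \<open>(n\<^sub>1, \<dots>, n\<^sub>n)\<close> are extensional functions on \<open>{1..n}\<close>, so that each tuple is counted
  exactly once.
\<close>

definition part_tuples :: "nat \<Rightarrow> (nat \<Rightarrow> nat) set" where
  "part_tuples n = {m \<in> {1..n} \<rightarrow>\<^sub>E UNIV. (\<Sum>k=1..n. k * m k) = n}"

definition part_coeff :: "(nat \<Rightarrow> real) \<Rightarrow> nat \<Rightarrow> real" where
  "part_coeff a n = (\<Sum>m\<in>part_tuples n. (\<Prod>k=1..n. a k ^ m k / fact (m k)))"

definition saddle :: "(nat \<Rightarrow> real) \<Rightarrow> nat \<Rightarrow> real" where
  "saddle a n = (THE s. (\<Sum>l=1..n. real l * a l * exp (- real l * s)) = real n)"

definition B_sq :: "(nat \<Rightarrow> real) \<Rightarrow> nat \<Rightarrow> real" where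
  "B_sq a n = (\<Sum>l=1..n. (real l)\<^sup>2 * a l * exp (- real l * saddle a n))"

text \<open>The sum in \<^const>\<open>part_coeff\<close> is over a finite set, so it is a genuine sum.\<close>

lemma finite_part_tuples: "finite (part_tuples n)"
proof (rule finite_subset)
  show "part_tuples n \<subseteq> {1..n} \<rightarrow>\<^sub>E {..n}"
  proof
    fix m assume m: "m \<in> part_tuples n"
    have "m k \<le> n" if k: "k \<in> {1..n}" for k
    proof -
      have "m k \<le> k * m k" using k by simp
      also have "\<dots> \<le> (\<Sum>k=1..n. k * m k)"
        by (rule member_le_sum[OF k]) auto
      also have "\<dots> = n" using m by (simp add: part_tuples_def)
      finally show ?thesis .
    qed
    with m show "m \<in> {1..n} \<rightarrow>\<^sub>E {..n}"
      by (auto simp: part_tuples_def PiE_iff)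
  qed
  show "finite ({1..n} \<rightarrow>\<^sub>E {..n})" by (intro finite_PiE) auto
qed

text \<open>The definite description in \<^const>\<open>saddle\<close> is well defined for \<open>n \<ge> 1\<close>.\<close>

lemma ex1_saddle:
  fixes a :: "nat \<Rightarrow> real"
  assumes pos: "\<And>j. j \<ge> 1 \<Longrightarrow> 0 < a j" and n: "n \<ge> 1"
  shows "\<exists>!s. (\<Sum>l=1..n. real l * a l * exp (- real l * s)) = real n"
proof -
  define f where "f s = (\<Sum>l=1..n. real l * a l * exp (- real l * s))" for s :: real
  have anti: "f t < f s" if "s < t" for s t
    unfolding f_def using n pos that by (intro sum_strict_mono) auto
  define S where "S = (\<Sum>l=1..n. real l * a l)"
  have S: "S > 0" unfolding S_def using n pos by (intro sum_pos) auto
  define lo where "lo = min 0 (- ln (real n / a 1))"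
  define hi where "hi = max 0 (ln (S / real n))"
  have a1: "a 1 > 0" using pos by simp
  have "real n = a 1 * exp (ln (real n / a 1))" using a1 n by simp
  also have "\<dots> \<le> a 1 * exp (- lo)" using a1 by (simp add: lo_def)
  also have "\<dots> = real 1 * a 1 * exp (- real 1 * lo)" by simp
  also have "\<dots> \<le> f lo" unfolding f_def
    by (rule member_le_sum[where f = "\<lambda>l. real l * a l * exp (- real l * lo)"])
      (use n pos in \<open>auto intro!: mult_nonneg_nonneg less_imp_le[OF pos]\<close>)
  finally have lo: "real n \<le> f lo" .
  have "f hi \<le> (\<Sum>l=1..n. real l * a l * exp (- hi))"
    unfolding f_def
  proof (rule sum_mono)
    fix l assume l: "l \<in> {1..n}"
    have "1 * hi \<le> real l * hi" using l by (intro mult_right_mono) (auto simp: hi_def)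
    then show "real l * a l * exp (- real l * hi) \<le> real l * a l * exp (- hi)"
      using l pos[of l] by (intro mult_left_mono) auto
  qed
  also have "\<dots> = S * exp (- hi)" by (simp add: S_def sum_distrib_right)
  also have "\<dots> \<le> S * exp (- ln (S / real n))" using S by (simp add: hi_def)
  also have "\<dots> = real n" using S n by (simp add: exp_minus)
  finally have hi: "f hi \<le> real n" .
  have "\<exists>s. lo \<le> s \<and> s \<le> hi \<and> f s = real n"
    using hi lo by (rule IVT2') (auto simp: f_def lo_def hi_def intro!: continuous_intros)
  moreover have "s = t" if "f s = real n" "f t = real n" for s t
    using anti[of s t] anti[of t s] that by (cases s t rule: linorder_cases) auto
  ultimately show ?thesis unfolding f_def by blast
qed

end

(*
  Write b_l = a_l exp(-l s) with s = sigma_n. Expanding the exponential of the polynomial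
  sum_{l<=n} b_l e^{ilt} and integrating against e^{-int} gives
    c_n = exp(n s + sum_l b_l) / (2 pi) * integral_{-pi}^{pi} exp(h(t)) dt,
    h(t) = sum_{l<=n} b_l (e^{ilt} - 1) - int,
  and the choice of s removes the linear term of h at 0. As n grows, s tends to 0 while n s >= 1,
  so all indices l <= 1/s occur in the sums. Cut the integral at T = s^(p/3 + 1 + eps/4).
  For |t| <= T the cubic error T^3 sum l^3 b_l = O(s^(3 eps/4)) vanishes, and B T >= c s^(-eps/4)
  tends to infinity, so this part contributes sqrt(2 pi) / B.
  For |t| >= T, Re h(t) <= -c min(t^2 / s^2, 1) s^(-p1) <= -c s^(-eps/2), p1 = 2p/3 + eps: if |t| is
  at most a multiple of s, compare 1 - cos(lt) with (lt)^2 for l up to a multiple of 1/s; otherwise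
  the cosines cancel over a block M < l <= 2M with M about 1/(2s). Since B is at most polynomial
  in 1/s, the remaining part is negligible.
*)
theory Submission
  imports Defs "HOL-Probability.Probability" "HOL-Real_Asymp.Real_Asymp"
begin

subsection \<open>The coefficients as Fourier integrals\<close>

lemma has_integral_cis_period:
  fixes k :: int
  shows "((\<lambda>t. cis (of_int k * t)) has_integral (if k = 0 then of_real (2 * pi) else 0)) {-pi..pi}"
proof (cases "k = 0")
  case True
  then show ?thesis
    using has_integral_const_real[of "1::complex" "-pi" pi] by (simp add: scaleR_conv_of_real)
next
  case False
  have "((\<lambda>t. cis (of_int k * t)) has_integral
      cis (of_int k * pi) / (\<i> * of_int k) - cis (of_int k * - pi) / (\<i> * of_int k)) {-pi..pi}"
  proof (intro fundamental_theorem_of_calculus)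
    fix t
    have "((\<lambda>z. exp (\<i> * of_int k * z) / (\<i> * of_int k)) has_field_derivative cis (of_int k * t))
        (at (of_real t))"
      using False by (auto intro!: derivative_eq_intros simp: cis_conv_exp mult_ac)
    from has_vector_derivative_real_field[OF this, of "{-pi..pi}"]
    show "((\<lambda>t. cis (of_int k * t) / (\<i> * of_int k)) has_vector_derivative cis (of_int k * t))
        (at t within {-pi..pi})"
      by (simp add: cis_conv_exp mult_ac)
  qed simp
  moreover have "cis (of_int k * pi) = cis (of_int k * - pi)"
    by (rule complex_eqI) (simp_all add: sin_npi_int mult.commute[of _ pi])
  ultimately show ?thesis using False by simp
qed

lemma prod_cis: "(\<Prod>k\<in>A. cis (f k)) = cis (\<Sum>k\<in>A. f k)"
  by (induction A rule: infinite_finite_induct) (simp_all add: cis_mult)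

text \<open>The product of the exponential series, multiplied out over all tuples of exponents. The
  absolute summability in the second part supplies the majorant that later allows termwise
  integration.\<close>

lemma exp_sum_eq_infsum_PiE:
  fixes x :: "nat \<Rightarrow> complex"
  assumes "finite A"
  shows "(\<Sum>\<^sub>\<infinity>m\<in>A \<rightarrow>\<^sub>E UNIV. \<Prod>k\<in>A. x k ^ m k / fact (m k)) = exp (\<Sum>k\<in>A. x k)"
    and "(\<lambda>m. norm (\<Prod>k\<in>A. x k ^ m k / fact (m k))) summable_on (A \<rightarrow>\<^sub>E UNIV)"
proof -
  have *: "(\<lambda>j. norm (x k ^ j / fact j)) summable_on UNIV" for k
    using summable_norm_exp[of "x k"]
    by (intro summable_on_UNIV_nonneg_real_iff[THEN iffD2])
      (auto simp: scaleR_conv_of_real field_simps norm_mult norm_divide norm_power)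
  have "((\<lambda>j. x k ^ j / fact j) has_sum exp (x k)) UNIV" for k
    using exp_converges[of "x k"] *[of k, unfolded summable_on_UNIV_nonneg_real_iff[OF norm_ge_zero]]
    by (intro norm_summable_imp_has_sum) (auto simp: scaleR_conv_of_real field_simps summable_on_UNIV_nonneg_real_iff)
  then have "(\<Sum>\<^sub>\<infinity>j. x k ^ j / fact j) = exp (x k)" for k
    by (rule infsumI)
  then show "(\<Sum>\<^sub>\<infinity>m\<in>A \<rightarrow>\<^sub>E UNIV. \<Prod>k\<in>A. x k ^ m k / fact (m k)) = exp (\<Sum>k\<in>A. x k)"
    using infsum_prod_PiE_abs[OF assms, of "\<lambda>k j. x k ^ j / fact j" "\<lambda>_. UNIV"] *
    by (simp add: exp_sum assms)
  show "(\<lambda>m. norm (\<Prod>k\<in>A. x k ^ m k / fact (m k))) summable_on (A \<rightarrow>\<^sub>E UNIV)"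
    using abs_summable_on_prod_PiE[OF assms, of "\<lambda>_. UNIV" "\<lambda>k j. x k ^ j / fact j"] *
    by (simp add: abs_summable_equivalent)
qed

text \<open>Expanded over all tuples in \<open>P\<close>, the integrand is a series of terms
  \<open>c m * cis (d m * t)\<close>, where \<open>d m\<close> is the weight of the tuple minus
  \<open>n\<close>. It converges uniformly in \<open>t\<close>, so it can be integrated term by
  term, and orthogonality keeps exactly the tuples of weight \<open>n\<close>.\<close>

lemma part_coeff_has_integral:
  fixes a :: "nat \<Rightarrow> real"
  shows "((\<lambda>t. exp (\<Sum>k=1..n. of_real (a k) * cis (real k * t)) * cis (- real n * t)) has_integral
     of_real (2 * pi * part_coeff a n)) {-pi..pi}"
proof -
  define P where "P = {1..n} \<rightarrow>\<^sub>E (UNIV :: nat set)"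
  define c where "c m = (\<Prod>k=1..n. a k ^ m k / fact (m k))" for m
  define d where "d m = int (\<Sum>k=1..n. k * m k) - int n" for m
  define F where "F t = exp (\<Sum>k=1..n. of_real (a k) * cis (real k * t)) * cis (- real n * t)" for t
  have prod: "(\<Prod>k=1..n. (of_real (a k) * cis (real k * t)) ^ m k / fact (m k)) * cis (- real n * t)
      = of_real (c m) * cis (of_int (d m) * t)" for m t
  proof -
    have "(\<Prod>k=1..n. (of_real (a k) * cis (real k * t)) ^ m k / fact (m k))
        = of_real (c m) * (\<Prod>k=1..n. cis (real k * t) ^ m k)"
      by (simp add: c_def power_mult_distrib prod.distrib prod_dividef)
    also have "(\<Prod>k=1..n. cis (real k * t) ^ m k) = cis (\<Sum>k=1..n. real k * real (m k) * t)"
      unfolding prod_cis [symmetric] by (intro prod.cong) (simp_all add: Complex.DeMoivre mult_ac)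
    finally show ?thesis
      by (simp add: cis_mult d_def algebra_simps sum_distrib_left)
  qed
  have F: "F t = (\<Sum>\<^sub>\<infinity>m\<in>P. of_real (c m) * cis (of_int (d m) * t))" for t
  proof -
    have "F t = (\<Sum>\<^sub>\<infinity>m\<in>P. (\<Prod>k=1..n. (of_real (a k) * cis (real k * t)) ^ m k / fact (m k))) * cis (- real n * t)"
      unfolding F_def P_def by (subst exp_sum_eq_infsum_PiE) auto
    also have "\<dots> = (\<Sum>\<^sub>\<infinity>m\<in>P. (\<Prod>k=1..n. (of_real (a k) * cis (real k * t)) ^ m k / fact (m k)) * cis (- real n * t))"
      by (rule infsum_cmult_left' [symmetric])
    finally show ?thesis unfolding prod .
  qed
  have "(\<lambda>m. norm (c m)) summable_on P"
    using exp_sum_eq_infsum_PiE(2)[of "{1..n}" "\<lambda>k. of_real (a k)"]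
    unfolding P_def c_def by (simp add: prod_norm[symmetric] norm_divide norm_power abs_prod power_abs)
  then have "uniform_limit {-pi..pi} (\<lambda>X t. \<Sum>m\<in>X. of_real (c m) * cis (of_int (d m) * t)) F
      (finite_subsets_at_top P)"
    unfolding F by (intro Weierstrass_m_test_general[where M = "\<lambda>m. norm (c m)"]) (simp_all add: norm_mult)
  then obtain I J where
    I: "\<And>X. ((\<lambda>t. \<Sum>m\<in>X. of_real (c m) * cis (of_int (d m) * t)) has_integral I X) {-pi..pi}"
    and J: "(F has_integral J) {-pi..pi}" and lim: "(I \<longlongrightarrow> J) (finite_subsets_at_top P)"
    by (rule uniform_limit_integral) (auto intro!: continuous_intros)
  \<comment> \<open>Terms outside \<open>part_tuples n\<close> integrate to 0, so the net of partial
    integrals is constant once \<open>X\<close> contains that finite set; its limit \<open>J\<close>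
    is then this constant.\<close>
  have "I X = of_real (2 * pi * part_coeff a n)" if X: "finite X" "part_tuples n \<subseteq> X" "X \<subseteq> P" for X
  proof -
    have "((\<lambda>t. \<Sum>m\<in>X. of_real (c m) * cis (of_int (d m) * t)) has_integral
        (\<Sum>m\<in>X. of_real (c m) * (if d m = 0 then of_real (2 * pi) else 0))) {-pi..pi}"
      by (intro has_integral_sum X has_integral_mult_right has_integral_cis_period)
    moreover have "(\<Sum>m\<in>X. of_real (c m) * (if d m = 0 then of_real (2 * pi) else 0))
        = (\<Sum>m\<in>part_tuples n. of_real (c m) * of_real (2 * pi) :: complex)"
      using X by (intro sum.mono_neutral_cong_right) (auto simp: part_tuples_def P_def d_def simp flip: of_nat_mult of_nat_sum)
    ultimately show ?thesis
      using I[of X] by (simp add: has_integral_unique part_coeff_def c_def sum_distrib_left mult_ac)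
  qed
  moreover have "part_tuples n \<subseteq> P" by (auto simp: part_tuples_def P_def)
  ultimately have "\<forall>\<^sub>F X in finite_subsets_at_top P. I X = of_real (2 * pi * part_coeff a n)"
    unfolding eventually_finite_subsets_at_top
    using finite_part_tuples[of n] by (intro exI[of _ "part_tuples n"]) auto
  then have "(I \<longlongrightarrow> of_real (2 * pi * part_coeff a n)) (finite_subsets_at_top P)"
    by (rule tendsto_eventually)
  with lim have "J = of_real (2 * pi * part_coeff a n)"
    by (intro tendsto_unique) auto
  with J show ?thesis by (simp add: F_def[abs_def])
qed

text \<open>Every monomial of the coefficient has weight \<open>n\<close>, so each one picks up the
  same factor \<open>r ^ n\<close>. With \<open>r = exp (- s)\<close> this passes from
  \<open>a\<close> to the tilted weights.\<close>

lemma part_coeff_scale: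
  "part_coeff (\<lambda>k. a k * r ^ k) n = part_coeff a n * r ^ n"
  unfolding part_coeff_def sum_distrib_right
proof (rule sum.cong)
  fix m assume m: "m \<in> part_tuples n"
  have "(\<Prod>k=1..n. (a k * r ^ k) ^ m k / fact (m k))
      = (\<Prod>k=1..n. a k ^ m k / fact (m k)) * (\<Prod>k=1..n. r ^ (k * m k))"
    by (simp add: power_mult_distrib power_mult prod.distrib[symmetric])
  also have "(\<Prod>k=1..n. r ^ (k * m k)) = r ^ n"
    using m by (simp add: part_tuples_def flip: power_sum)
  finally show "(\<Prod>k=1..n. (a k * r ^ k) ^ m k / fact (m k)) = (\<Prod>k=1..n. a k ^ m k / fact (m k)) * r ^ n" .
qed simp

subsection \<open>Laplace's method\<close>

text \<open>Substituting \<open>t = u / B n\<close> turns the central part into an integral over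
  \<open>\<bar>u\<bar> \<le> B n * T n\<close>, whose integrand tends to the Gaussian; dominated
  convergence applies there. The outer part has length at most \<open>2 * pi\<close> and integrand
  at most \<open>exp (- \<rho> n)\<close> in norm.\<close>

lemma Laplace_method:
  fixes h :: "nat \<Rightarrow> real \<Rightarrow> complex" and B T \<rho> \<delta> :: "nat \<Rightarrow> real"
  assumes cont: "\<And>n. continuous_on UNIV (h n)"
    and B: "\<forall>\<^sub>F n in sequentially. 0 < B n"
    and T: "\<forall>\<^sub>F n in sequentially. T n \<le> pi"
    and near: "\<forall>\<^sub>F n in sequentially. \<forall>t. \<bar>t\<bar> \<le> T n \<longrightarrow> norm (h n t + of_real ((B n * t)\<^sup>2 / 2)) \<le> \<delta> n"
    and far: "\<forall>\<^sub>F n in sequentially. \<forall>t. T n \<le> \<bar>t\<bar> \<and> \<bar>t\<bar> \<le> pi \<longrightarrow> Re (h n t) \<le> - \<rho> n"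
    and \<delta>: "\<delta> \<longlonglongrightarrow> 0"
    and BT: "filterlim (\<lambda>n. B n * T n) at_top sequentially"
    and B\<rho>: "(\<lambda>n. B n * exp (- \<rho> n)) \<longlonglongrightarrow> 0"
  shows "(\<lambda>n. of_real (B n) * integral {-pi..pi} (\<lambda>t. exp (h n t))) \<longlonglongrightarrow> of_real (sqrt (2 * pi))"
proof -
  define I where "I n = {- (B n * T n)..B n * T n}" for n
  \<comment> \<open>The rescaled integrand is cut off by an indicator, so that all integrals run
    over the same whole line.\<close>
  define f where "f n u = indicat_real (I n) u *\<^sub>R exp (h n (u / B n))" for n u
  have BT0: "\<forall>\<^sub>F n in sequentially. 0 < B n * T n"
    using BT by (simp add: filterlim_at_top_dense)
  have \<delta>1: "\<forall>\<^sub>F n in sequentially. \<delta> n < 1"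
    using \<delta> by (rule order_tendstoD) simp
  have good: "\<forall>\<^sub>F n in sequentially. 0 < B n \<and> 0 < T n \<and> T n \<le> pi \<and> \<delta> n < 1 \<and>
      (\<forall>t. \<bar>t\<bar> \<le> T n \<longrightarrow> norm (h n t + of_real ((B n * t)\<^sup>2 / 2)) \<le> \<delta> n) \<and>
      (\<forall>t. T n \<le> \<bar>t\<bar> \<and> \<bar>t\<bar> \<le> pi \<longrightarrow> Re (h n t) \<le> - \<rho> n)"
    using B T near far BT0 \<delta>1 by eventually_elim (auto simp: zero_less_mult_iff)
  then obtain N where N: "\<And>n. n \<ge> N \<Longrightarrow> 0 < B n \<and> 0 < T n \<and> T n \<le> pi \<and> \<delta> n < 1 \<and>
      (\<forall>t. \<bar>t\<bar> \<le> T n \<longrightarrow> norm (h n t + of_real ((B n * t)\<^sup>2 / 2)) \<le> \<delta> n) \<and>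
      (\<forall>t. T n \<le> \<bar>t\<bar> \<and> \<bar>t\<bar> \<le> pi \<longrightarrow> Re (h n t) \<le> - \<rho> n)"
    unfolding eventually_sequentially by blast
  have near': "norm (h n (u / B n) + of_real (u\<^sup>2 / 2)) \<le> \<delta> n" if "n \<ge> N" "u \<in> I n" for n u
  proof -
    have "\<bar>u / B n\<bar> \<le> T n" using N[OF that(1)] that(2) by (auto simp: I_def abs_if field_simps)
    then have "norm (h n (u / B n) + of_real ((B n * (u / B n))\<^sup>2 / 2)) \<le> \<delta> n"
      using N[OF that(1)] by blast
    then show ?thesis using N[OF that(1)] by simp
  qed
  have gauss: "integrable lborel (\<lambda>u::real. exp (- u\<^sup>2 / 2))"
       "(\<integral>u. exp (- u\<^sup>2 / 2) \<partial>lborel) = sqrt (2 * pi)"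
  proof -
    have eq: "(\<lambda>u. exp (- u\<^sup>2 / 2)) = (\<lambda>u. sqrt (2 * pi) * std_normal_density u)"
      by (auto simp: std_normal_density_def)
    show "integrable lborel (\<lambda>u::real. exp (- u\<^sup>2 / 2))"
      unfolding eq using integrable_std_normal_moment[of 0] by (intro integrable_mult_right) simp
    show "(\<integral>u. exp (- u\<^sup>2 / 2) \<partial>lborel) = sqrt (2 * pi)"
      unfolding eq using integral_std_normal_moment_even[of 0] by simp
  qed
  have cont': "continuous_on UNIV (\<lambda>u. exp (h n (u / B n)))" if "n \<ge> N" for n
    using N[OF that] by (intro continuous_on_exp continuous_on_compose2[OF cont]) (auto intro!: continuous_intros)
  have meas [measurable]: "f n \<in> borel_measurable lborel" if "n \<ge> N" for n
    unfolding f_def using borel_measurable_continuous_onI[OF cont'[OF that]] by (simp add: I_def)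
  \<comment> \<open>The index is shifted by \<open>N\<close> because dominated convergence requires
    measurability and the majorant at every index. The factor \<open>exp 1\<close> in the majorant
    comes from \<open>\<delta> n < 1\<close>.\<close>
  have "(\<lambda>n. \<integral>u. f (n + N) u \<partial>lborel) \<longlonglongrightarrow> (\<integral>u. of_real (exp (- u\<^sup>2 / 2)) \<partial>lborel)"
  proof (rule integral_dominated_convergence[where w = "\<lambda>u. exp 1 * exp (- u\<^sup>2 / 2)"])
    show "integrable lborel (\<lambda>u::real. exp 1 * exp (- u\<^sup>2 / 2) :: real)"
      using gauss(1) by (rule integrable_mult_right)
    show "AE u in lborel. norm (f (n + N) u) \<le> exp 1 * exp (- u\<^sup>2 / 2)" for n
    proof (rule AE_I2)
      fix u
      let ?z = "h (n + N) (u / B (n + N))"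
      show "norm (f (n + N) u) \<le> exp 1 * exp (- u\<^sup>2 / 2)"
      proof (cases "u \<in> I (n + N)")
        case True
        have "Re ?z + u\<^sup>2 / 2 \<le> norm (?z + of_real (u\<^sup>2 / 2))"
          using complex_Re_le_cmod[of "?z + of_real (u\<^sup>2 / 2)"] by simp
        also have "\<dots> \<le> 1" using near'[OF _ True] N[of "n + N"] by fastforce
        finally have "Re ?z \<le> 1 + (- u\<^sup>2 / 2)" by simp
        then have "exp (Re ?z) \<le> exp 1 * exp (- u\<^sup>2 / 2)"
          unfolding exp_add[symmetric] by simp
        then show ?thesis using True by (simp add: f_def)
      qed (simp add: f_def)
    qed
    show "AE u in lborel. (\<lambda>n. f (n + N) u) \<longlonglongrightarrow> of_real (exp (- u\<^sup>2 / 2))"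
    proof (rule AE_I2)
      fix u :: real
      have "\<forall>\<^sub>F n in sequentially. \<bar>u\<bar> \<le> B n * T n"
        using BT by (simp add: filterlim_at_top)
      then have ev: "\<forall>\<^sub>F n in sequentially. u \<in> I n"
        by eventually_elim (auto simp: I_def)
      have "(\<lambda>n. h n (u / B n) + of_real (u\<^sup>2 / 2)) \<longlonglongrightarrow> 0"
      proof (rule Lim_null_comparison[OF _ \<delta>])
        show "\<forall>\<^sub>F n in sequentially. norm (h n (u / B n) + of_real (u\<^sup>2 / 2)) \<le> \<delta> n"
          using ev eventually_ge_at_top[of N] by eventually_elim (rule near')
      qed
      then have "(\<lambda>n. exp ((h n (u / B n) + of_real (u\<^sup>2 / 2)) - of_real (u\<^sup>2 / 2))) \<longlonglongrightarrow> exp (0 - of_real (u\<^sup>2 / 2))"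
        by (intro tendsto_intros)
      then have "(\<lambda>n. exp (h n (u / B n))) \<longlonglongrightarrow> of_real (exp (- u\<^sup>2 / 2))"
        by (simp flip: exp_of_real)
      moreover have "\<forall>\<^sub>F n in sequentially. exp (h n (u / B n)) = f n u"
        using ev by eventually_elim (simp add: f_def)
      ultimately have "(\<lambda>n. f n u) \<longlonglongrightarrow> of_real (exp (- u\<^sup>2 / 2))"
        by (rule Lim_transform_eventually)
      then show "(\<lambda>n. f (n + N) u) \<longlonglongrightarrow> of_real (exp (- u\<^sup>2 / 2))"
        by (rule LIMSEQ_ignore_initial_segment)
    qed
  qed (use meas in auto)
  then have f_lim: "(\<lambda>n. \<integral>u. f n u \<partial>lborel) \<longlonglongrightarrow> of_real (sqrt (2 * pi))"
    unfolding integral_complex_of_real gauss(2) by (rule LIMSEQ_offset)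

  define g where "g n t = exp (h n t)" for n t
  have gint: "g n integrable_on {x..y}" for n x y
    unfolding g_def by (intro integrable_continuous_real continuous_on_exp continuous_on_subset[OF cont]) auto
  \<comment> \<open>Undoes the substitution; the Jacobian is the factor \<open>B n\<close> of the
    conclusion.\<close>
  have inner: "(\<integral>u. f n u \<partial>lborel) = of_real (B n) * integral {-T n..T n} (g n)" if n: "n \<ge> N" for n
  proof -
    have "set_integrable lborel (I n) (\<lambda>u. exp (h n (u / B n)))"
      unfolding I_def by (intro borel_integrable_atLeastAtMost' continuous_on_subset[OF cont'[OF n]]) auto
    then have "(\<integral>u. f n u \<partial>lborel) = integral (I n) (\<lambda>u. exp (h n (u / B n)))"
      unfolding f_def by (subst set_borel_integral_eq_integral(2)[symmetric]) (auto simp: set_lebesgue_integral_def)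
    moreover have "((\<lambda>u. g n (u / B n)) has_integral B n *\<^sub>R integral {-T n..T n} (g n)) (I n)"
    proof -
      have "((\<lambda>u. g n (inverse (B n) *\<^sub>R u)) has_integral ((1 / inverse (B n)) *\<^sub>R integral {-T n..T n} (g n))) ((\<lambda>x. x / inverse (B n)) ` {-T n..T n})"
        using has_integral_stretch_real[OF integrable_integral[OF gint], of "inverse (B n)" n "-T n" "T n"] N[OF n] by simp
      moreover have "(\<lambda>x. x / inverse (B n)) ` {-T n..T n} = I n"
      proof -
        have "(\<lambda>x. x / inverse (B n)) ` {-T n..T n} = (\<lambda>x. B n * x) ` {-T n..T n}"
          by (intro image_cong) (simp_all add: divide_inverse mult.commute)
        also have "\<dots> = I n"
          using image_mult_atLeastAtMost[of "B n" "- T n" "T n"] N[OF n] by (simp add: I_def)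
        finally show ?thesis .
      qed
      moreover have "(\<lambda>u. g n (inverse (B n) *\<^sub>R u)) = (\<lambda>u. g n (u / B n))"
        by (simp add: divide_inverse mult.commute)
      ultimately show ?thesis by (simp only: divide_inverse mult_1 inverse_inverse_eq)
    qed
    ultimately show ?thesis
      by (simp add: g_def integral_unique scaleR_conv_of_real)
  qed
  have outer: "norm (of_real (B n) * integral {-pi..pi} (g n) - (\<integral>u. f n u \<partial>lborel))
      \<le> 2 * pi * (B n * exp (- \<rho> n))" if n: "n \<ge> N" for n
  proof -
    note Nn = N[OF n]
    have split: "integral {-pi..pi} (g n) = integral {-pi..-T n} (g n) + integral {-T n..T n} (g n) + integral {T n..pi} (g n)"
    proof -
      have "integral {-pi..-T n} (g n) + integral {-T n..pi} (g n) = integral {-pi..pi} (g n)"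
        using Nn gint by (intro Henstock_Kurzweil_Integration.integral_combine) auto
      moreover have "integral {-T n..T n} (g n) + integral {T n..pi} (g n) = integral {-T n..pi} (g n)"
        using Nn gint by (intro Henstock_Kurzweil_Integration.integral_combine) auto
      ultimately show ?thesis by (metis add.assoc)
    qed
    have le: "norm (g n t) \<le> exp (- \<rho> n)" if "T n \<le> \<bar>t\<bar>" "\<bar>t\<bar> \<le> pi" for t
      using Nn that by (auto simp: g_def)
    have cg: "continuous_on {x..y} (g n)" for x y
      unfolding g_def by (intro continuous_on_exp continuous_on_subset[OF cont]) auto
    have "norm (integral {-pi..-T n} (g n)) \<le> exp (- \<rho> n) * (- T n - - pi)"
      using Nn by (intro integral_bound cg le) auto
    moreover have "norm (integral {T n..pi} (g n)) \<le> exp (- \<rho> n) * (pi - T n)"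
      using Nn by (intro integral_bound cg le) auto
    ultimately have "norm (integral {-pi..-T n} (g n) + integral {T n..pi} (g n)) \<le> exp (- \<rho> n) * (2 * (pi - T n))"
      by (intro order_trans[OF norm_triangle_ineq]) (simp add: algebra_simps)
    also have "\<dots> \<le> exp (- \<rho> n) * (2 * pi)"
      using Nn by (intro mult_left_mono) auto
    finally have *: "norm (integral {-pi..-T n} (g n) + integral {T n..pi} (g n)) \<le> exp (- \<rho> n) * (2 * pi)" .
    have "of_real (B n) * integral {-pi..pi} (g n) - (\<integral>u. f n u \<partial>lborel)
        = of_real (B n) * (integral {-pi..-T n} (g n) + integral {T n..pi} (g n))"
      unfolding inner[OF n] split by (simp add: algebra_simps)
    also have "norm \<dots> = B n * norm (integral {-pi..-T n} (g n) + integral {T n..pi} (g n))"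
      using Nn by (simp add: norm_mult)
    also have "\<dots> \<le> B n * (exp (- \<rho> n) * (2 * pi))"
      using Nn * by (intro mult_left_mono) auto
    finally show ?thesis by (simp add: mult_ac)
  qed
  have "(\<lambda>n. of_real (B n) * integral {-pi..pi} (g n) - (\<integral>u. f n u \<partial>lborel)) \<longlonglongrightarrow> 0"
  proof (rule Lim_null_comparison)
    show "\<forall>\<^sub>F n in sequentially. norm (of_real (B n) * integral {-pi..pi} (g n) - (\<integral>u. f n u \<partial>lborel))
        \<le> 2 * pi * (B n * exp (- \<rho> n))"
      using eventually_ge_at_top[of N] by eventually_elim (rule outer)
    show "(\<lambda>n. 2 * pi * (B n * exp (- \<rho> n))) \<longlonglongrightarrow> 0"
      by (rule tendsto_mult_right_zero[OF B\<rho>])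
  qed
  from tendsto_add[OF this f_lim] show ?thesis by (simp add: g_def[abs_def])
qed

subsection \<open>Moments of the weights\<close>

text \<open>Half of the exponential absorbs the power of \<open>l * s\<close>; the other half leaves
  a geometric series of ratio \<open>exp (- s / 2)\<close>, whose sum is at most
  \<open>2 / s\<close> for every \<open>n\<close>.\<close>

lemma sum_powr_exp_le:
  fixes \<alpha> :: real
  assumes "\<alpha> > 0"
  shows "\<exists>C>0. \<forall>s>0. \<forall>n. (\<Sum>l=1..n. real l powr \<alpha> * exp (- real l * s)) \<le> C * s powr (- \<alpha> - 1)"
proof (intro exI conjI allI impI)
  define K where "K = (2 * \<alpha>) powr \<alpha>"
  show "2 * K > 0" using assms by (simp add: K_def)
  fix s :: real and n :: nat assume s: "s > 0"
  \<comment> \<open>This is \<open>ln y \<le> y - 1\<close> at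
    \<open>y = x / (2 * \<alpha>)\<close>, multiplied by \<open>\<alpha>\<close>; the gain of
    \<open>- \<alpha>\<close> is dropped, which explains the simple value of
    \<open>K\<close>.\<close>
  have K: "x powr \<alpha> \<le> K * exp (x / 2)" if "x > 0" for x
  proof -
    have "ln (x / (2 * \<alpha>)) \<le> x / (2 * \<alpha>) - 1"
      using that assms by (intro ln_le_minus_one) simp
    then have "\<alpha> * ln (x / (2 * \<alpha>)) \<le> \<alpha> * (x / (2 * \<alpha>) - 1)"
      using assms by (intro mult_left_mono) auto
    also have "\<dots> \<le> x / 2" using assms by (simp add: field_simps)
    finally have "\<alpha> * ln x \<le> \<alpha> * ln (2 * \<alpha>) + x / 2"
      using that assms by (simp add: ln_div algebra_simps)
    then show ?thesis using that assms by (simp add: powr_def K_def flip: exp_add)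
  qed
  define q where "q = exp (- s / 2)"
  have q: "0 < q" "q < 1" "1 / q - 1 \<ge> s / 2"
    using s exp_ge_add_one_self[of "s / 2"] by (auto simp: q_def exp_minus inverse_eq_divide simp del: exp_ge_add_one_self)
  \<comment> \<open>Telescoping: each term becomes \<open>q ^ (l - 1) - q ^ l\<close>.\<close>
  have "(\<Sum>l=1..n. q ^ l) * (1 / q - 1) = 1 - q ^ n"
    using q by (induction n) (simp_all add: algebra_simps)
  then have "(\<Sum>l=1..n. q ^ l) * (s / 2) \<le> 1"
    using q by (smt (verit) mult_left_mono sum_nonneg zero_le_power zero_less_power)
  then have geo: "(\<Sum>l=1..n. q ^ l) \<le> 2 / s"
    using s by (simp add: field_simps)
  have "(\<Sum>l=1..n. real l powr \<alpha> * exp (- real l * s)) \<le> (\<Sum>l=1..n. K * s powr (- \<alpha>) * q ^ l)"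
  proof (rule sum_mono)
    fix l assume l: "l \<in> {1..n}"
    have "real l powr \<alpha> * exp (- real l * s) = s powr (- \<alpha>) * ((real l * s) powr \<alpha> * exp (- real l * s))"
      using s l by (simp add: powr_mult powr_minus field_simps)
    also have "\<dots> \<le> s powr (- \<alpha>) * (K * exp (real l * s / 2) * exp (- real l * s))"
      using s l by (intro mult_left_mono mult_right_mono K) auto
    also have "\<dots> = K * s powr (- \<alpha>) * (exp (real l * s / 2) * exp (- real l * s))" by simp
    also have "exp (real l * s / 2) * exp (- real l * s) = q ^ l"
      by (simp add: q_def flip: exp_add exp_of_nat_mult)
    finally show "real l powr \<alpha> * exp (- real l * s) \<le> K * s powr (- \<alpha>) * q ^ l" .
  qed
  also have "\<dots> = K * s powr (- \<alpha>) * (\<Sum>l=1..n. q ^ l)" by (simp add: sum_distrib_left)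
  also have "\<dots> \<le> K * s powr (- \<alpha>) * (2 / s)"
    using geo by (intro mult_left_mono) (auto simp: K_def)
  also have "\<dots> = 2 * K * s powr (- \<alpha> - 1)"
    using s by (simp add: powr_diff)
  finally show "(\<Sum>l=1..n. real l powr \<alpha> * exp (- real l * s)) \<le> 2 * K * s powr (- \<alpha> - 1)" .
qed

text \<open>Only the upper half of the indices is kept: at least \<open>M / 2\<close> of them, each
  at least \<open>M / 2\<close>.\<close>

lemma sum_powr_ge:
  fixes \<beta> :: real
  assumes "\<beta> \<ge> 0"
  shows "(real M / 2) powr (\<beta> + 1) \<le> (\<Sum>l=1..M. real l powr \<beta>)"
proof (cases "M = 0")
  case False
  have "(real M / 2) powr (\<beta> + 1) = (real M / 2) * (real M / 2) powr \<beta>"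
    using False by (simp add: powr_add)
  also have "\<dots> \<le> real (card {(M + 1) div 2..M}) * (real M / 2) powr \<beta>"
    by (intro mult_right_mono) auto
  also have "\<dots> = (\<Sum>l\<in>{(M + 1) div 2..M}. (real M / 2) powr \<beta>)"
    by simp
  also have "\<dots> \<le> (\<Sum>l\<in>{(M + 1) div 2..M}. real l powr \<beta>)"
    using assms by (intro sum_mono powr_mono2) auto
  also have "\<dots> \<le> (\<Sum>l=1..M. real l powr \<beta>)"
    using False by (intro sum_mono2) auto
  finally show ?thesis .
qed simp

text \<open>The finitely many early terms are positive, so adjusting the two constants extends the
  eventual bounds to every \<open>j \<ge> 1\<close>.\<close>

lemma seq_class_bounds:
  assumes a: "a \<in> seq_class p1 p2"
  obtains \<gamma>1 \<gamma>2 where "\<gamma>1 > 0" "\<gamma>2 > 0"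
    "\<And>j. j \<ge> 1 \<Longrightarrow> \<gamma>1 * real j powr (p1 - 1) \<le> a j"
    "\<And>j. j \<ge> 1 \<Longrightarrow> a j \<le> \<gamma>2 * real j powr (p2 - 1)"
proof -
  from a obtain g1 g2 J where g: "g1 > 0" "g2 > 0" and pos: "\<And>j. j \<ge> 1 \<Longrightarrow> 0 < a j"
    and J: "\<And>j. j \<ge> J \<Longrightarrow> g1 * real j powr (p1 - 1) \<le> a j \<and> a j \<le> g2 * real j powr (p2 - 1)"
    unfolding seq_class_def eventually_sequentially by auto
  define \<gamma>1 where "\<gamma>1 = Min (insert g1 ((\<lambda>j. a j / real j powr (p1 - 1)) ` {1..J}))"
  define \<gamma>2 where "\<gamma>2 = Max (insert g2 ((\<lambda>j. a j / real j powr (p2 - 1)) ` {1..J}))"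
  have "\<gamma>1 > 0" unfolding \<gamma>1_def using g pos by (subst Min_gr_iff) auto
  have le: "\<gamma>1 \<le> g1" "g2 \<le> \<gamma>2" unfolding \<gamma>1_def \<gamma>2_def by auto
  have "\<gamma>1 * real j powr (p1 - 1) \<le> a j" if "j \<ge> 1" for j
  proof (cases "j \<le> J")
    case True
    have "\<gamma>1 \<le> a j / real j powr (p1 - 1)" unfolding \<gamma>1_def using True that by (intro Min_le) auto
    then show ?thesis using that by (simp add: pos_le_divide_eq)
  next
    case False
    have "\<gamma>1 * real j powr (p1 - 1) \<le> g1 * real j powr (p1 - 1)"
      using le by (intro mult_right_mono) auto
    with J[of j] False show ?thesis by linarith
  qed
  moreover have "a j \<le> \<gamma>2 * real j powr (p2 - 1)" if "j \<ge> 1" for j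
  proof (cases "j \<le> J")
    case True
    have "a j / real j powr (p2 - 1) \<le> \<gamma>2" unfolding \<gamma>2_def using True that by (intro Max_ge) auto
    then show ?thesis using that by (simp add: pos_divide_le_eq)
  next
    case False
    have "g2 * real j powr (p2 - 1) \<le> \<gamma>2 * real j powr (p2 - 1)"
      using le by (intro mult_right_mono) auto
    with J[of j] False show ?thesis by linarith
  qed
  ultimately show ?thesis using that[of \<gamma>1 \<gamma>2] \<open>\<gamma>1 > 0\<close> g le by simp
qed

text \<open>Used with \<open>q = 1\<close> to locate the saddle point, \<open>q = 2\<close> for
  \<open>B_sq\<close> and \<open>q = 3\<close> for the cubic error. The bound is uniform in
  \<open>n\<close>.\<close>

lemma moment_le:
  assumes "p > 0" "q \<ge> 1" "\<gamma> > 0" and le: "\<And>j. j \<ge> 1 \<Longrightarrow> a j \<le> \<gamma> * real j powr (p - 1)"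
  shows "\<exists>C>0. \<forall>s>0. \<forall>n. (\<Sum>l=1..n. real l ^ q * a l * exp (- real l * s)) \<le> C * s powr (- (p + real q))"
proof -
  have "p + real q - 1 > 0" using assms by simp
  from sum_powr_exp_le[OF this] obtain C where C: "C > 0"
    "\<And>s n. s > 0 \<Longrightarrow> (\<Sum>l=1..n. real l powr (p + real q - 1) * exp (- real l * s)) \<le> C * s powr (- (p + real q - 1) - 1)"
    by blast
  have "(\<Sum>l=1..n. real l ^ q * a l * exp (- real l * s)) \<le> \<gamma> * C * s powr (- (p + real q))" if s: "s > 0" for s n
  proof -
    have "(\<Sum>l=1..n. real l ^ q * a l * exp (- real l * s))
        \<le> (\<Sum>l=1..n. \<gamma> * (real l powr (p + real q - 1) * exp (- real l * s)))"
    proof (rule sum_mono)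
      fix l assume l: "l \<in> {1..n}"
      have "real l ^ q * a l * exp (- real l * s) \<le> real l ^ q * (\<gamma> * real l powr (p - 1)) * exp (- real l * s)"
        using l by (intro mult_left_mono mult_right_mono le) auto
      also have "\<dots> = \<gamma> * ((real l powr real q * real l powr (p - 1)) * exp (- real l * s))"
        using l by (simp add: powr_realpow)
      also have "real l powr real q * real l powr (p - 1) = real l powr (p + real q - 1)"
        by (simp add: algebra_simps flip: powr_add)
      finally show "real l ^ q * a l * exp (- real l * s) \<le> \<gamma> * (real l powr (p + real q - 1) * exp (- real l * s))" .
    qed
    also have "\<dots> \<le> \<gamma> * (C * s powr (- (p + real q - 1) - 1))"
      unfolding sum_distrib_left[symmetric] using assms C(2)[OF s] by (intro mult_left_mono) auto
    finally show ?thesis by simp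
  qed
  with C(1) assms(3) show ?thesis by (intro exI[of _ "\<gamma> * C"]) auto
qed

text \<open>For \<open>l \<le> 1 / (K * s)\<close> the exponential factor is at least
  \<open>exp (-1)\<close>, so a pure power sum remains. The sum stays truncated since its range must
  fit below \<open>n\<close>, and for \<open>K = 32\<close> also satisfy
  \<open>l * \<bar>t\<bar> \<le> 1\<close>.\<close>

lemma moment_ge:
  assumes "p > 0" "q \<ge> 1" "\<gamma> > 0" "K \<ge> 1" and ge: "\<And>j. j \<ge> 1 \<Longrightarrow> \<gamma> * real j powr (p - 1) \<le> a j"
  shows "\<exists>c>0. \<forall>s>0. s \<le> 1 / (2 * K) \<longrightarrow>
      c * s powr (- (p + real q)) \<le> (\<Sum>l=1..nat \<lfloor>1 / (K * s)\<rfloor>. real l ^ q * a l * exp (- real l * s))"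
proof -
  \<comment> \<open>The condition \<open>s \<le> 1 / (2 * K)\<close> lets the floor cost at most a
    factor 2, so \<open>M / 2\<close> is at least \<open>1 / (4 * K * s)\<close>.\<close>
  define c where "c = \<gamma> * exp (-1) * (4 * K) powr (- (p + real q))"
  have "c * s powr (- (p + real q)) \<le> (\<Sum>l=1..nat \<lfloor>1 / (K * s)\<rfloor>. real l ^ q * a l * exp (- real l * s))"
    if s: "s > 0" "s \<le> 1 / (2 * K)" for s
  proof -
    define M where "M = nat \<lfloor>1 / (K * s)\<rfloor>"
    have M1: "real M \<le> 1 / (K * s)" using s assms by (simp add: M_def)
    have "1 / (2 * K * s) \<ge> 1" using s assms by (simp add: field_simps)
    moreover have "real M \<ge> 1 / (K * s) - 1" using s assms unfolding M_def by linarith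
    ultimately have M2: "real M \<ge> 1 / (2 * K * s)" by (simp add: field_simps)
    have "real M * s \<le> 1 / K" using M1 s assms by (simp add: field_simps)
    also have "\<dots> \<le> 1" using assms by simp
    finally have Ms: "real M * s \<le> 1" .
    have "c * s powr (- (p + real q)) = \<gamma> * exp (-1) * (4 * K * s) powr (- (p + real q))"
      using s assms by (simp add: c_def powr_mult)
    also have "\<dots> = \<gamma> * exp (-1) * (1 / (4 * K * s)) powr (p + real q)"
      using s assms by (subst powr_minus) (simp add: powr_divide inverse_eq_divide)
    also have "\<dots> \<le> \<gamma> * exp (-1) * (real M / 2) powr (p + real q)"
      using M2 s assms by (intro mult_left_mono powr_mono2) (auto simp: field_simps)
    also have "\<dots> \<le> \<gamma> * exp (-1) * (\<Sum>l=1..M. real l powr (p + real q - 1))"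
      using sum_powr_ge[of "p + real q - 1" M] assms by (intro mult_left_mono) auto
    also have "\<dots> \<le> (\<Sum>l=1..M. real l ^ q * a l * exp (- real l * s))"
      unfolding sum_distrib_left
    proof (rule sum_mono)
      fix l assume l: "l \<in> {1..M}"
      have "real l * s \<le> real M * s" using l s by (intro mult_right_mono) auto
      then have e: "exp (-1) \<le> exp (- real l * s)" using Ms by simp
      have "real l powr (p + real q - 1) = real l powr real q * real l powr (p - 1)"
        by (simp add: algebra_simps flip: powr_add)
      then have "\<gamma> * exp (-1) * real l powr (p + real q - 1) = real l ^ q * (\<gamma> * real l powr (p - 1)) * exp (-1)"
        using l by (simp add: powr_realpow)
      also have "\<dots> \<le> real l ^ q * a l * exp (- real l * s)"
      proof (intro mult_mono mult_nonneg_nonneg mult_left_mono e)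
        show "0 \<le> a l" using ge[of l] l assms by (intro order_trans[OF _ ge]) auto
      qed (use l ge[of l] assms in auto)
      finally show "\<gamma> * exp (-1) * real l powr (p + real q - 1) \<le> real l ^ q * a l * exp (- real l * s)" .
    qed
    finally show ?thesis by (simp add: M_def)
  qed
  moreover have "c > 0" using assms by (simp add: c_def)
  ultimately show ?thesis by blast
qed

subsection \<open>The characteristic exponent\<close>

lemma cis_minus_quadratic_le:
  "norm (cis x - 1 - \<i> * of_real x + of_real (x\<^sup>2 / 2)) \<le> \<bar>x\<bar> ^ 3 / 6"
proof -
  have "(\<Sum>k\<le>2. (\<i> * of_real x) ^ k / fact k) = 1 + \<i> * of_real x - of_real (x\<^sup>2 / 2)"
    by (simp add: numeral_2_eq_2 power2_eq_square field_simps)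
  then have eq: "cis x - 1 - \<i> * of_real x + of_real (x\<^sup>2 / 2) = iexp x - (\<Sum>k\<le>2. (\<i> * of_real x) ^ k / fact k)"
    by (simp only: cis_conv_exp) simp
  show ?thesis
    unfolding eq using iexp_approx1[of x 2] by (simp add: fact_numeral)
qed

text \<open>For \<open>\<bar>x\<bar> \<le> 1\<close> the cubic Taylor error is at most a sixth of
  the square of \<open>x\<close>, and 1/2 - 1/6 = 1/3.\<close>

lemma one_minus_cos_ge:
  fixes x :: real
  assumes "\<bar>x\<bar> \<le> 1"
  shows "x\<^sup>2 / 3 \<le> 1 - cos x"
proof -
  have "\<bar>cos x - 1 + x\<^sup>2 / 2\<bar> \<le> \<bar>x\<bar> ^ 3 / 6"
    using order_trans[OF abs_Re_le_cmod cis_minus_quadratic_le[of x]] by simp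
  moreover have "\<bar>x\<bar> ^ 3 \<le> x\<^sup>2"
    using power_decreasing[of 2 3 "\<bar>x\<bar>"] assms by simp
  ultimately show ?thesis by linarith
qed

lemma sin_ge_linear:
  fixes x :: real
  assumes "0 \<le> x" "x \<le> pi / 2"
  shows "x / 2 \<le> sin x"
proof (cases "x \<le> pi / 3")
  case True
  have "(\<lambda>x. sin x - x / 2) 0 \<le> (\<lambda>x. sin x - x / 2) x"
  proof (rule DERIV_nonneg_imp_nondecreasing[OF assms(1)])
    fix y assume y: "0 \<le> y" "y \<le> x"
    have "cos (pi / 3) \<le> cos y" using y True by (intro cos_monotone_0_pi_le) auto
    then show "\<exists>d. ((\<lambda>x. sin x - x / 2) has_real_derivative d) (at y) \<and> 0 \<le> d"
      by (intro exI[of _ "cos y - 1 / 2"]) (auto intro!: derivative_eq_intros simp: cos_60)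
  qed
  then show ?thesis by simp
next
  \<comment> \<open>Beyond \<open>pi / 3\<close> the sine is at least sqrt 3 / 2, hence at least
    0.85, while \<open>x / 2\<close> is at most pi / 4 < 0.8.\<close>
  case False
  have "sin (pi / 3) \<le> sin x" using assms False by (intro sin_monotone_2pi_le) auto
  moreover have "sqrt 3 \<ge> 1.7" by (rule real_le_rsqrt) (simp add: power2_eq_square)
  ultimately show ?thesis using assms pi_less_4 pi_approx by (simp add: sin_60)
qed

lemma abs_sin_half_ge:
  fixes t :: real
  assumes "\<bar>t\<bar> \<le> pi"
  shows "\<bar>t\<bar> / 4 \<le> \<bar>sin (t / 2)\<bar>"
  using sin_ge_linear[of "t / 2"] sin_ge_linear[of "- t / 2"] assms by (cases "t \<ge> 0") auto

text \<open>Multiplication by \<open>2 * sin (t / 2)\<close> makes the sum telescope to a difference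
  of two sines. The bound does not depend on the length of the block.\<close>

lemma sum_cos_le:
  fixes t :: real
  assumes "\<bar>t\<bar> \<le> pi" "t \<noteq> 0" "m \<le> n"
  shows "(\<Sum>l=m+1..n. cos (real l * t)) \<le> 4 / \<bar>t\<bar>"
proof -
  have "(\<Sum>l=m+1..n. cos (real l * t)) * (2 * sin (t / 2)) = sin ((real n + 1 / 2) * t) - sin ((real m + 1 / 2) * t)"
    using assms(3)
  proof (induction n rule: dec_induct)
    case (step n)
    have "cos (real (Suc n) * t) * (2 * sin (t / 2)) = sin ((real (Suc n) + 1 / 2) * t) - sin ((real n + 1 / 2) * t)"
    proof -
      have 1: "(real (Suc n) + 1 / 2) * t = real (Suc n) * t + t / 2" "(real n + 1 / 2) * t = real (Suc n) * t - t / 2"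
        by (simp_all add: algebra_simps)
      show ?thesis unfolding 1 sin_add sin_diff by simp
    qed
    with step show ?case by (simp add: distrib_right)
  qed simp
  then have "\<bar>\<Sum>l=m+1..n. cos (real l * t)\<bar> * (2 * \<bar>sin (t / 2)\<bar>) = \<bar>sin ((real n + 1 / 2) * t) - sin ((real m + 1 / 2) * t)\<bar>"
    by (metis abs_mult abs_numeral)
  also have "\<dots> \<le> 1 + 1"
    by (rule order_trans[OF abs_triangle_ineq4]) (intro add_mono abs_sin_le_one)
  finally have *: "\<bar>\<Sum>l=m+1..n. cos (real l * t)\<bar> * \<bar>sin (t / 2)\<bar> \<le> 1" by simp
  have "\<bar>\<Sum>l=m+1..n. cos (real l * t)\<bar> * (\<bar>t\<bar> / 4) \<le> \<bar>\<Sum>l=m+1..n. cos (real l * t)\<bar> * \<bar>sin (t / 2)\<bar>"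
    by (intro mult_left_mono abs_sin_half_ge assms) simp
  with * have "\<bar>\<Sum>l=m+1..n. cos (real l * t)\<bar> * (\<bar>t\<bar> / 4) \<le> 1" by linarith
  then have "\<bar>\<Sum>l=m+1..n. cos (real l * t)\<bar> \<le> 4 / \<bar>t\<bar>"
    using assms(2) by (simp add: field_simps)
  then show ?thesis by linarith
qed

section \<open>The exponent near 0 and away from 0\<close>

text \<open>For nonnegative \<open>b\<close>, its exponential is the characteristic function of the
  sum of \<open>l * N_l\<close> minus \<open>n\<close>, where the \<open>N_l\<close> are independent
  Poisson variables of mean \<open>b l\<close>.\<close>

definition char_exponent :: "(nat \<Rightarrow> real) \<Rightarrow> nat \<Rightarrow> real \<Rightarrow> complex" where
  "char_exponent b n t = (\<Sum>l=1..n. of_real (b l) * (cis (real l * t) - 1)) - \<i> * of_real (real n * t)"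

lemma Re_char_exponent: "Re (char_exponent b n t) = - (\<Sum>l=1..n. b l * (1 - cos (real l * t)))"
  by (simp add: char_exponent_def sum_negf[symmetric] algebra_simps del: sum_negf)

lemma continuous_on_char_exponent: "continuous_on S (char_exponent b n)"
  unfolding char_exponent_def by (intro continuous_intros)

text \<open>The hypothesis \<open>mean\<close> is the saddle point equation. It rewrites the term
  linear in \<open>n * t\<close> as the sum of the linear Taylor terms, so these cancel and only
  cubic remainders are left.\<close>

lemma char_exponent_quadratic:
  assumes b: "\<And>l. l \<ge> 1 \<Longrightarrow> 0 \<le> b l" and mean: "(\<Sum>l=1..n. real l * b l) = real n"
  shows "norm (char_exponent b n t + of_real ((\<Sum>l=1..n. (real l)\<^sup>2 * b l) * t\<^sup>2 / 2))
    \<le> \<bar>t\<bar> ^ 3 / 6 * (\<Sum>l=1..n. real l ^ 3 * b l)"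
proof -
  have "char_exponent b n t + of_real ((\<Sum>l=1..n. (real l)\<^sup>2 * b l) * t\<^sup>2 / 2)
     = (\<Sum>l=1..n. of_real (b l) * (cis (real l * t) - 1 - \<i> * of_real (real l * t) + of_real ((real l * t)\<^sup>2 / 2)))"
    unfolding char_exponent_def mean[symmetric]
    by (simp add: algebra_simps sum.distrib sum_subtractf sum_distrib_left sum_distrib_right power_mult_distrib sum_divide_distrib)
  also have "norm \<dots> \<le> (\<Sum>l=1..n. b l * (\<bar>real l * t\<bar> ^ 3 / 6))"
  proof (intro order_trans[OF norm_sum] sum_mono)
    fix l assume "l \<in> {1..n}"
    then have "0 \<le> b l" using b by simp
    then show "norm (of_real (b l) * (cis (real l * t) - 1 - \<i> * of_real (real l * t) + of_real ((real l * t)\<^sup>2 / 2)))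
        \<le> b l * (\<bar>real l * t\<bar> ^ 3 / 6)"
      using mult_left_mono[OF cis_minus_quadratic_le[of "real l * t"], of "b l"] by (simp add: norm_mult)
  qed
  also have "\<dots> = \<bar>t\<bar> ^ 3 / 6 * (\<Sum>l=1..n. real l ^ 3 * b l)"
    by (simp add: sum_distrib_left abs_mult power_mult_distrib mult_ac)
  finally show ?thesis .
qed

text \<open>All summands \<open>b l * (1 - cos (l * t))\<close> are nonnegative, so those with
  \<open>l > M\<close> may be discarded; for the others \<open>l * t\<close> lies in the range of
  \<open>one_minus_cos_ge\<close>.\<close>

lemma Re_char_exponent_le_quadratic:
  assumes b: "\<And>l. l \<ge> 1 \<Longrightarrow> 0 \<le> b l" and "M \<le> n" "real M * \<bar>t\<bar> \<le> 1"
  shows "Re (char_exponent b n t) \<le> - (t\<^sup>2 / 3 * (\<Sum>l=1..M. (real l)\<^sup>2 * b l))"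
proof -
  have "t\<^sup>2 / 3 * (\<Sum>l=1..M. (real l)\<^sup>2 * b l) = (\<Sum>l=1..M. b l * ((real l * t)\<^sup>2 / 3))"
    by (simp add: sum_distrib_left power_mult_distrib mult_ac)
  also have "\<dots> \<le> (\<Sum>l=1..M. b l * (1 - cos (real l * t)))"
  proof (intro sum_mono mult_left_mono one_minus_cos_ge)
    fix l assume l: "l \<in> {1..M}"
    then have "real l * \<bar>t\<bar> \<le> real M * \<bar>t\<bar>" by (intro mult_right_mono) auto
    then show "\<bar>real l * t\<bar> \<le> 1" using assms(3) by (simp add: abs_mult)
    show "0 \<le> b l" using b l by simp
  qed
  also have "\<dots> \<le> (\<Sum>l=1..n. b l * (1 - cos (real l * t)))"
    using assms(2) b by (intro sum_mono2) auto
  finally show ?thesis by (simp add: Re_char_exponent)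
qed

text \<open>On the block the cosines sum to at most \<open>4 / \<bar>t\<bar>\<close>, which is at
  most half the block length since \<open>M * \<bar>t\<bar> \<ge> 8\<close>. Thus
  \<open>1 - cos\<close> is at least 1/2 on average.\<close>

lemma Re_char_exponent_le_block:
  assumes b: "\<And>l. l \<ge> 1 \<Longrightarrow> 0 \<le> b l" and "2 * M \<le> n" "\<bar>t\<bar> \<le> pi" "8 \<le> real M * \<bar>t\<bar>"
    and \<beta>: "0 \<le> \<beta>" "\<And>l. l \<in> {M+1..2*M} \<Longrightarrow> \<beta> \<le> b l"
  shows "Re (char_exponent b n t) \<le> - (\<beta> * real M / 2)"
proof -
  have t: "t \<noteq> 0" using assms(4) by auto
  have "(\<Sum>l=M+1..2*M. cos (real l * t)) \<le> 4 / \<bar>t\<bar>"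
    by (intro sum_cos_le t assms) simp
  also have "\<dots> \<le> real M / 2" using assms(4) t by (simp add: field_simps)
  finally have "real M / 2 \<le> (\<Sum>l=M+1..2*M. 1 - cos (real l * t))"
    by (simp add: sum_subtractf)
  then have "\<beta> * (real M / 2) \<le> \<beta> * (\<Sum>l=M+1..2*M. 1 - cos (real l * t))"
    using \<beta>(1) by (rule mult_left_mono)
  also have "\<dots> \<le> (\<Sum>l=M+1..2*M. b l * (1 - cos (real l * t)))"
    unfolding sum_distrib_left by (intro sum_mono mult_right_mono \<beta>) auto
  also have "\<dots> \<le> (\<Sum>l=1..n. b l * (1 - cos (real l * t)))"
    using assms(2) b by (intro sum_mono2) auto
  finally show ?thesis by (simp add: Re_char_exponent)
qed

subsection \<open>The saddle point\<close>

lemma saddle_eq: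
  assumes "\<And>j. j \<ge> 1 \<Longrightarrow> 0 < a j" and "n \<ge> 1"
  shows "(\<Sum>l=1..n. real l * a l * exp (- real l * saddle a n)) = real n"
  unfolding saddle_def by (rule theI'[OF ex1_saddle[OF assms]])

text \<open>The left side of the saddle point equation decreases in \<open>s\<close>, so the
  solution is located by comparing values with \<open>n\<close>: at \<open>s = 1 / n\<close> the
  value eventually exceeds \<open>n\<close>, while at a fixed \<open>e > 0\<close> it is bounded in
  \<open>n\<close>.\<close>

lemma saddle_asymptotics:
  assumes p: "p1 > 0" "p2 > 0" and \<gamma>: "\<gamma>1 > 0" "\<gamma>2 > 0"
    and ge: "\<And>j. j \<ge> 1 \<Longrightarrow> \<gamma>1 * real j powr (p1 - 1) \<le> a j"
    and le: "\<And>j. j \<ge> 1 \<Longrightarrow> a j \<le> \<gamma>2 * real j powr (p2 - 1)"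
  shows "\<forall>\<^sub>F n in sequentially. 1 \<le> real n * saddle a n"
    and "filterlim (saddle a) (at_right 0) sequentially"
proof -
  have pos: "0 < a j" if "j \<ge> 1" for j
    using ge[OF that] \<gamma> that by (intro less_le_trans[OF _ ge]) auto
  define f where "f n x = (\<Sum>l=1..n. real l * a l * exp (- real l * x))" for n x
  have anti: "f n y \<le> f n x" if "x \<le> y" for n x y
    unfolding f_def using that by (intro sum_mono mult_left_mono) (auto intro!: mult_nonneg_nonneg less_imp_le[OF pos])
  have f: "f n (saddle a n) = real n" if "n \<ge> 1" for n
    unfolding f_def using that by (intro saddle_eq pos)
  show ev: "\<forall>\<^sub>F n in sequentially. 1 \<le> real n * saddle a n"
  proof -
    \<comment> \<open>With \<open>K = 1\<close> and \<open>s = 1 / n\<close> the truncation point is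
      exactly \<open>n\<close>, so the truncated sum is the full \<open>f n (1 / n)\<close>;
      \<open>s \<le> 1 / 2\<close> becomes \<open>n \<ge> 2\<close>.\<close>
    obtain c where c: "c > 0" "\<And>s. s > 0 \<Longrightarrow> s \<le> 1 / 2 \<Longrightarrow>
      c * s powr (- (p1 + 1)) \<le> (\<Sum>l=1..nat \<lfloor>1 / s\<rfloor>. real l * a l * exp (- real l * s))"
      using moment_ge[where q = 1 and K = 1, OF p(1) _ \<gamma>(1) _ ge] by auto
    have "\<forall>\<^sub>F n::nat in sequentially. real n < c * real n powr (p1 + 1)"
      using c(1) p(1) by real_asymp
    then show ?thesis using eventually_ge_at_top[of 2]
    proof eventually_elim
      case (elim n)
      have "c * (1 / real n) powr (- (p1 + 1)) \<le> f n (1 / real n)"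
        using c(2)[of "1 / real n"] elim by (simp add: f_def)
      also have "(1 / real n) powr (- (p1 + 1)) = real n powr (p1 + 1)"
        by (subst powr_minus) (simp add: powr_divide)
      finally have "f n (saddle a n) < f n (1 / real n)"
        using elim f[of n] by simp
      then have "1 / real n < saddle a n"
        using anti[of "saddle a n" "1 / real n" n] by linarith
      then show ?case using elim by (simp add: field_simps)
    qed
  qed
  obtain C where C: "C > 0" "\<And>s n. s > 0 \<Longrightarrow> f n s \<le> C * s powr (- (p2 + 1))"
    using moment_le[where q = 1, OF p(2) _ \<gamma>(2) le] by (auto simp: f_def)
  have pos': "\<forall>\<^sub>F n in sequentially. saddle a n > 0"
    using ev
  proof eventually_elim
    case (elim n)
    show ?case
    proof (rule ccontr)
      assume "\<not> saddle a n > 0"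
      then have "real n * saddle a n \<le> 0" by (intro mult_nonneg_nonpos) auto
      with elim show False by simp
    qed
  qed
  have lim: "saddle a \<longlonglongrightarrow> 0"
  proof (rule order_tendstoI)
    fix e :: real assume e: "0 < e"
    have "\<forall>\<^sub>F n in sequentially. C * e powr (- (p2 + 1)) < real n"
      by real_asymp
    then show "\<forall>\<^sub>F n in sequentially. saddle a n < e"
      using eventually_ge_at_top[of 1]
    proof eventually_elim
      case (elim n)
      then have "f n e < f n (saddle a n)" using C(2)[OF e, of n] f[of n] by simp
      then show ?case using anti[of e "saddle a n" n] by linarith
    qed
  next
    fix e :: real assume "e < 0"
    with pos' show "\<forall>\<^sub>F n in sequentially. e < saddle a n" by (auto elim: eventually_mono)
  qed
  with pos' show "filterlim (saddle a) (at_right 0) sequentially"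
    by (auto simp: filterlim_at elim: eventually_mono)
qed

section \<open>Uniform decay of the integrand\<close>

text \<open>The two arguments of the minimum come from two regimes, split at
  \<open>\<bar>t\<bar> = 32 * s\<close>: the quadratic bound below, the block bound above. The limit
  \<open>1 / 64\<close> on \<open>s\<close> is what \<open>moment_ge\<close> asks for with
  \<open>K = 32\<close>.\<close>

lemma Re_char_exponent_le_min:
  assumes p: "p > 0" and \<gamma>: "\<gamma> > 0" and ge: "\<And>j. j \<ge> 1 \<Longrightarrow> \<gamma> * real j powr (p - 1) \<le> a j"
  shows "\<exists>c>0. \<forall>s>0. \<forall>n t. s \<le> 1 / 64 \<and> 1 \<le> real n * s \<and> \<bar>t\<bar> \<le> pi \<longrightarrow>
    Re (char_exponent (\<lambda>l. a l * exp (- real l * s)) n t)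
      \<le> - (c * min (t\<^sup>2 * s powr (- (p + 2))) (s powr (- p)))"
proof -
  have pos: "0 < a j" if "j \<ge> 1" for j
    using ge[OF that] \<gamma> that by (intro less_le_trans[OF _ ge]) auto
  obtain c2 where c2: "c2 > 0" "\<And>s. s > 0 \<Longrightarrow> s \<le> 1 / 64 \<Longrightarrow>
    c2 * s powr (- (p + 2)) \<le> (\<Sum>l=1..nat \<lfloor>1 / (32 * s)\<rfloor>. (real l)\<^sup>2 * a l * exp (- real l * s))"
    using moment_ge[where q = 2 and K = 32, OF p _ \<gamma> _ ge] by auto
  define c3 where "c3 = \<gamma> * exp (-1) / 4 * 4 powr (- p)"
  define c where "c = min (c2 / 3) c3"
  have c: "c > 0" "c \<le> c2 / 3" "c \<le> c3" using c2(1) \<gamma> by (auto simp: c_def c3_def)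
  have "Re (char_exponent (\<lambda>l. a l * exp (- real l * s)) n t)
      \<le> - (c * min (t\<^sup>2 * s powr (- (p + 2))) (s powr (- p)))"
    if s: "s > 0" "s \<le> 1 / 64" "1 \<le> real n * s" and t: "\<bar>t\<bar> \<le> pi" for s n t
  proof -
    define b where "b l = a l * exp (- real l * s)" for l
    have b: "0 \<le> b l" if "l \<ge> 1" for l using pos[OF that] by (simp add: b_def)
    show ?thesis
    proof (cases "\<bar>t\<bar> \<le> 32 * s")
      case True
      define M where "M = nat \<lfloor>1 / (32 * s)\<rfloor>"
      have M: "real M \<le> 1 / (32 * s)" using s by (simp add: M_def)
      have "real M \<le> real n"
        using s by (intro order_trans[OF M]) (simp add: field_simps)
      moreover have "real M * \<bar>t\<bar> \<le> 1 / (32 * s) * (32 * s)"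
        using M True s by (intro mult_mono) auto
      ultimately have "Re (char_exponent b n t) \<le> - (t\<^sup>2 / 3 * (\<Sum>l=1..M. (real l)\<^sup>2 * b l))"
        using s b by (intro Re_char_exponent_le_quadratic) auto
      moreover have "t\<^sup>2 / 3 * (c2 * s powr (- (p + 2))) \<le> t\<^sup>2 / 3 * (\<Sum>l=1..M. (real l)\<^sup>2 * b l)"
        using c2(2)[OF s(1,2)] by (intro mult_left_mono) (auto simp: M_def b_def mult_ac)
      moreover have "c * min (t\<^sup>2 * s powr (- (p + 2))) (s powr (- p)) \<le> c2 / 3 * (t\<^sup>2 * s powr (- (p + 2)))"
        using c by (intro mult_mono) auto
      ultimately show ?thesis by (simp add: b_def[abs_def] mult_ac)
    next
      case False
      \<comment> \<open>Large enough that \<open>M \<ge> 1 / (4 * s)\<close>, so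
        \<open>M * \<bar>t\<bar> \<ge> 8\<close>; small enough that
        \<open>2 * M * s \<le> 1 \<le> n * s\<close>, so the block fits below \<open>n\<close> and
        the exponential stays above \<open>exp (-1)\<close> on it.\<close>
      define M where "M = nat \<lfloor>1 / (2 * s)\<rfloor>"
      have M: "real M \<le> 1 / (2 * s)" using s by (simp add: M_def)
      have "real M \<ge> 1 / (2 * s) - 1" using s unfolding M_def by linarith
      moreover have "1 / (4 * s) \<ge> 1" using s by (simp add: field_simps)
      ultimately have M4: "real M \<ge> 1 / (4 * s)" by (simp add: field_simps)
      with s have M0: "real M > 0" by (intro less_le_trans[OF _ M4]) auto
      have Ms: "2 * real M * s \<le> 1" using M s by (simp add: field_simps)
      have "2 * real M * s \<le> real n * s" using Ms s(3) by linarith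
      then have "2 * real M \<le> real n" using s(1) by (rule mult_right_le_imp_le)
      then have Mn: "2 * M \<le> n" by linarith
      have "8 = 1 / (4 * s) * (32 * s)" using s by simp
      also have "\<dots> \<le> real M * \<bar>t\<bar>" using M4 False s by (intro mult_mono) auto
      finally have 8: "8 \<le> real M * \<bar>t\<bar>" .
      \<comment> \<open>Writing the power \<open>p - 1\<close> as \<open>l powr p / l\<close> and
        bounding numerator and denominator separately covers both signs of
        \<open>p - 1\<close>.\<close>
      define \<beta> where "\<beta> = \<gamma> * (real M powr p / (2 * real M)) * exp (-1)"
      have \<beta>: "\<beta> \<le> b l" if l: "l \<in> {M+1..2*M}" for l
      proof -
        have "real l * s \<le> (2 * real M) * s" using l s by (intro mult_right_mono) auto
        then have e: "exp (-1) \<le> exp (- real l * s)" using Ms by simp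
        have "real M powr p / (2 * real M) \<le> real l powr p / real l"
          using l p by (intro frac_le powr_mono2) auto
        also have "\<dots> = real l powr (p - 1)" using l by (simp add: powr_diff)
        finally have "\<beta> \<le> \<gamma> * real l powr (p - 1) * exp (- real l * s)"
          unfolding \<beta>_def using \<gamma> e by (intro mult_mono) auto
        also have "\<dots> \<le> b l" unfolding b_def using l by (intro mult_right_mono ge) auto
        finally show ?thesis .
      qed
      have "Re (char_exponent b n t) \<le> - (\<beta> * real M / 2)"
        using Mn 8 t b \<beta> \<gamma> by (intro Re_char_exponent_le_block) (auto simp: \<beta>_def)
      moreover have "c3 * s powr (- p) \<le> \<beta> * real M / 2"
      proof -
        have "c3 * s powr (- p) = \<gamma> * exp (-1) / 4 * (4 * s) powr (- p)"
          using s by (simp add: c3_def powr_mult)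
        also have "\<dots> = \<gamma> * exp (-1) / 4 * (1 / (4 * s)) powr p"
          using s by (subst powr_minus) (simp add: powr_divide inverse_eq_divide)
        also have "\<dots> \<le> \<gamma> * exp (-1) / 4 * real M powr p"
          using M4 s p \<gamma> by (intro mult_left_mono powr_mono2) auto
        also have "\<dots> = \<beta> * real M / 2" using M0 by (simp add: \<beta>_def)
        finally show ?thesis .
      qed
      moreover have "c * min (t\<^sup>2 * s powr (- (p + 2))) (s powr (- p)) \<le> c3 * s powr (- p)"
        using c by (intro mult_mono) auto
      ultimately show ?thesis by (simp add: b_def[abs_def])
    qed
  qed
  with c(1) show ?thesis by blast
qed

text \<open>Cauchy's formula on the circle of radius \<open>exp (- s)\<close>, in tilted form: the
  Fourier integral is taken for \<open>b\<close>, scaling back to \<open>a\<close> costs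
  \<open>exp (n * s)\<close>, and the value of the integrand at \<open>t = 0\<close> is pulled
  out.\<close>

lemma part_coeff_eq_integral:
  fixes a :: "nat \<Rightarrow> real" and s :: real
  defines "b \<equiv> \<lambda>l. a l * exp (- real l * s)"
  shows "of_real (part_coeff a n) = of_real (exp (real n * s + (\<Sum>l=1..n. b l)) / (2 * pi)) *
    integral {-pi..pi} (\<lambda>t. exp (char_exponent b n t))"
proof -
  have "exp (\<Sum>k=1..n. of_real (b k) * cis (real k * t)) * cis (- real n * t)
      = of_real (exp (\<Sum>l=1..n. b l)) * exp (char_exponent b n t)" for t
    by (simp add: char_exponent_def cis_conv_exp algebra_simps sum_subtractf flip: exp_add exp_of_real)
  with part_coeff_has_integral[where a = b and n = n]
  have *: "of_real (exp (\<Sum>l=1..n. b l)) * integral {-pi..pi} (\<lambda>t. exp (char_exponent b n t))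
      = of_real (2 * pi * part_coeff b n)"
    by (simp add: has_integral_iff)
  have "b = (\<lambda>l. a l * exp (- s) ^ l)" by (simp add: b_def flip: exp_of_nat_mult)
  then have "part_coeff b n = part_coeff a n * exp (- (real n * s))"
    using part_coeff_scale[of a "exp (- s)" n] by (simp flip: exp_of_nat_mult)
  then have "part_coeff a n = exp (real n * s) / (2 * pi) * (2 * pi * part_coeff b n)"
    by (simp add: exp_minus)
  then have "of_real (part_coeff a n) = of_real (exp (real n * s) / (2 * pi)) * (of_real (2 * pi * part_coeff b n) :: complex)"
    by (simp only: of_real_mult)
  then show ?thesis unfolding *[symmetric] by (simp add: exp_add)
qed

section \<open>Choice of the cut and verification of the Laplace hypotheses\<close>

theorem mainTheorem2:
  fixes p \<epsilon> :: real and a :: "nat \<Rightarrow> real"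
  assumes "0 < p" and "0 < \<epsilon>" and "\<epsilon> \<le> p / 3"
    and "a \<in> seq_class (2 * p / 3 + \<epsilon>) p"
  shows "(\<lambda>n. part_coeff a n) \<sim>[sequentially]
    (\<lambda>n. 1 / sqrt (2 * pi * B_sq a n) *
      exp (real n * saddle a n + (\<Sum>j=1..n. a j * exp (- real j * saddle a n))))"
proof -
  define p1 where "p1 = 2 * p / 3 + \<epsilon>"
  have p1: "p1 > 0" using assms by (simp add: p1_def)
  obtain \<gamma>1 \<gamma>2 where \<gamma>: "\<gamma>1 > 0" "\<gamma>2 > 0"
    and ge: "\<And>j. j \<ge> 1 \<Longrightarrow> \<gamma>1 * real j powr (p1 - 1) \<le> a j"
    and le: "\<And>j. j \<ge> 1 \<Longrightarrow> a j \<le> \<gamma>2 * real j powr (p - 1)"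
    using seq_class_bounds[OF assms(4)] unfolding p1_def by metis
  have pos: "0 < a j" if "j \<ge> 1" for j
    using ge[OF that] \<gamma> that by (intro less_le_trans[OF _ ge]) auto
  define s where "s n = saddle a n" for n
  define b where "b n l = a l * exp (- real l * s n)" for n l
  define h where "h n = char_exponent (b n) n" for n
  define B where "B n = sqrt (B_sq a n)" for n
  \<comment> \<open>The cubic error vanishes for exponents above \<open>p / 3 + 1\<close>; the tail
    decay and the growth of \<open>B n * T n\<close> need one below
    \<open>p1 / 2 + 1 = p / 3 + 1 + \<epsilon> / 2\<close>. The midpoint is taken.\<close>
  define T where "T n = s n powr (p / 3 + 1 + \<epsilon> / 4)" for n
  have ns: "\<forall>\<^sub>F n in sequentially. 1 \<le> real n * s n" and s_lim: "filterlim s (at_right 0) sequentially"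
    using saddle_asymptotics[OF p1 assms(1) \<gamma> ge le] by (simp_all add: s_def[abs_def])
  \<comment> \<open>Transfers statements about \<open>x\<close> tending to 0 from the right to the
    saddle points, so growth comparisons can be made in a real variable.\<close>
  have small: "\<forall>\<^sub>F n in sequentially. P (s n)" if "\<forall>\<^sub>F x in at_right 0. P x" for P
    using s_lim that unfolding filterlim_iff by blast
  have "\<forall>\<^sub>F x in at_right 0. 0 < x \<and> x \<le> (1 / 64 :: real)"
    by (auto intro: eventually_at_rightI[of 0 "1 / 64"])
  from small[OF this] have s: "\<forall>\<^sub>F n in sequentially. 0 < s n \<and> s n \<le> 1 / 64" .
  have BB: "B_sq a n = (\<Sum>l=1..n. (real l)\<^sup>2 * b n l)" for n
    by (simp add: B_sq_def b_def s_def mult_ac)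
  have B_nonneg: "B_sq a n \<ge> 0" for n
    unfolding BB b_def by (intro sum_nonneg) (auto intro!: mult_nonneg_nonneg less_imp_le[OF pos])

  obtain c1 where c1: "c1 > 0" "\<And>s. s > 0 \<Longrightarrow> s \<le> 1 / 2 \<Longrightarrow>
    c1 * s powr (- (p1 + 2)) \<le> (\<Sum>l=1..nat \<lfloor>1 / s\<rfloor>. (real l)\<^sup>2 * a l * exp (- real l * s))"
    using moment_ge[where q = 2 and K = 1, OF p1 _ \<gamma>(1) _ ge] by auto
  \<comment> \<open>Since \<open>n * s n \<ge> 1\<close>, the sum truncated at
    \<open>1 / s n\<close> is part of the sum up to \<open>n\<close>.\<close>
  have B_ge: "\<forall>\<^sub>F n in sequentially. c1 * s n powr (- (p1 + 2)) \<le> B_sq a n"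
    using s ns
  proof eventually_elim
    case (elim n)
    have "1 / s n \<le> real n" using elim by (simp add: field_simps)
    then have "nat \<lfloor>1 / s n\<rfloor> \<le> n" by linarith
    then have "(\<Sum>l=1..nat \<lfloor>1 / s n\<rfloor>. (real l)\<^sup>2 * a l * exp (- real l * s n)) \<le> B_sq a n"
      unfolding B_sq_def s_def
      by (intro sum_mono2) (auto intro!: mult_nonneg_nonneg less_imp_le[OF pos])
    with c1(2)[of "s n"] elim show ?case by simp
  qed
  obtain C2 where C2: "C2 > 0" "\<And>s n. s > 0 \<Longrightarrow>
    (\<Sum>l=1..n. (real l)\<^sup>2 * a l * exp (- real l * s)) \<le> C2 * s powr (- (p + 2))"
    using moment_le[where q = 2, OF assms(1) _ \<gamma>(2) le] by auto
  obtain C3 where C3: "C3 > 0" "\<And>s n. s > 0 \<Longrightarrow>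
    (\<Sum>l=1..n. real l ^ 3 * a l * exp (- real l * s)) \<le> C3 * s powr (- (p + 3))"
    using moment_le[where q = 3, OF assms(1) _ \<gamma>(2) le] by auto
  obtain c where c: "c > 0" "\<And>s n t. s > 0 \<Longrightarrow> s \<le> 1 / 64 \<Longrightarrow> 1 \<le> real n * s \<Longrightarrow> \<bar>t\<bar> \<le> pi \<Longrightarrow>
    Re (char_exponent (\<lambda>l. a l * exp (- real l * s)) n t)
      \<le> - (c * min (t\<^sup>2 * s powr (- (p1 + 2))) (s powr (- p1)))"
    using Re_char_exponent_le_min[OF p1 \<gamma>(1) ge] by blast

  have "(\<lambda>n. of_real (B n) * integral {-pi..pi} (\<lambda>t. exp (h n t))) \<longlonglongrightarrow> of_real (sqrt (2 * pi))"
  proof (rule Laplace_method[where T = T and \<delta> = "\<lambda>n. C3 / 6 * s n powr (3 * \<epsilon> / 4)" and \<rho> = "\<lambda>n. c * s n powr (- \<epsilon> / 2)"])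
    show "continuous_on UNIV (h n)" for n
      unfolding h_def by (rule continuous_on_char_exponent)
    show "\<forall>\<^sub>F n in sequentially. 0 < B n"
      using B_ge s
    proof eventually_elim
      case (elim n)
      have "0 < c1 * s n powr (- (p1 + 2))" using elim c1 by simp
      with elim show ?case by (simp add: B_def)
    qed
    show "\<forall>\<^sub>F n in sequentially. T n \<le> pi"
      unfolding T_def
    proof (rule small)
      show "\<forall>\<^sub>F x in at_right 0. x powr (p / 3 + 1 + \<epsilon> / 4) \<le> pi"
        using assms(1,2) pi_gt_zero by real_asymp
    qed
    show "\<forall>\<^sub>F n in sequentially. \<forall>t. \<bar>t\<bar> \<le> T n \<longrightarrow>
        norm (h n t + of_real ((B n * t)\<^sup>2 / 2)) \<le> C3 / 6 * s n powr (3 * \<epsilon> / 4)"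
      using s eventually_ge_at_top[of 1]
    proof eventually_elim
      case (elim n)
      show ?case
      proof (intro allI impI)
        fix t assume t: "\<bar>t\<bar> \<le> T n"
        have "norm (h n t + of_real ((B n * t)\<^sup>2 / 2)) \<le> \<bar>t\<bar> ^ 3 / 6 * (\<Sum>l=1..n. real l ^ 3 * b n l)"
        proof -
          have "norm (char_exponent (b n) n t + of_real ((\<Sum>l=1..n. (real l)\<^sup>2 * b n l) * t\<^sup>2 / 2))
            \<le> \<bar>t\<bar> ^ 3 / 6 * (\<Sum>l=1..n. real l ^ 3 * b n l)"
          proof (rule char_exponent_quadratic)
            show "(\<Sum>l=1..n. real l * b n l) = real n"
              using saddle_eq[of a n, OF pos] elim by (simp add: b_def s_def mult_ac)
          qed (auto simp: b_def intro!: mult_nonneg_nonneg less_imp_le[OF pos])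
          then show ?thesis
            using B_nonneg[of n] by (simp add: h_def B_def BB power_mult_distrib)
        qed
        also have "\<dots> \<le> T n ^ 3 / 6 * (C3 * s n powr (- (p + 3)))"
          using C3(2)[of "s n" n] elim t
          by (intro mult_mono divide_right_mono power_mono)
            (auto simp: b_def T_def mult_ac intro!: sum_nonneg mult_nonneg_nonneg less_imp_le[OF pos])
        also have "T n ^ 3 = s n powr (3 * (p / 3 + 1 + \<epsilon> / 4))"
          using elim by (simp add: T_def powr_power mult_ac)
        also have "\<dots> / 6 * (C3 * s n powr (- (p + 3))) = C3 / 6 * (s n powr (3 * (p / 3 + 1 + \<epsilon> / 4)) * s n powr (- (p + 3)))"
          by simp
        also have "s n powr (3 * (p / 3 + 1 + \<epsilon> / 4)) * s n powr (- (p + 3)) = s n powr (3 * \<epsilon> / 4)"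
          by (simp add: field_simps flip: powr_add)
        finally show "norm (h n t + of_real ((B n * t)\<^sup>2 / 2)) \<le> C3 / 6 * s n powr (3 * \<epsilon> / 4)" .
      qed
    qed
    show "\<forall>\<^sub>F n in sequentially. \<forall>t. T n \<le> \<bar>t\<bar> \<and> \<bar>t\<bar> \<le> pi \<longrightarrow> Re (h n t) \<le> - (c * s n powr (- \<epsilon> / 2))"
      using s ns
    proof eventually_elim
      case (elim n)
      show ?case
      proof (intro allI impI)
        fix t assume t: "T n \<le> \<bar>t\<bar> \<and> \<bar>t\<bar> \<le> pi"
        have "s n powr (- \<epsilon> / 2) = s n powr (2 * (p / 3 + 1 + \<epsilon> / 4)) * s n powr (- (p1 + 2))"
          by (simp add: p1_def field_simps flip: powr_add)
        also have "s n powr (2 * (p / 3 + 1 + \<epsilon> / 4)) = (T n)\<^sup>2"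
          using elim by (simp add: T_def powr_power mult_ac)
        also have "(T n)\<^sup>2 \<le> t\<^sup>2"
          using t power_mono[of "T n" "\<bar>t\<bar>" 2] by (simp add: T_def)
        finally have "s n powr (- \<epsilon> / 2) \<le> t\<^sup>2 * s n powr (- (p1 + 2))"
          by (simp add: mult_right_mono)
        \<comment> \<open>Covers the flat regime of the minimum:
          \<open>\<epsilon> / 2 \<le> p1\<close> and \<open>s n \<le> 1\<close>.\<close>
        moreover have "s n powr (- \<epsilon> / 2) \<le> s n powr (- p1)"
          using elim assms(1,2) by (intro powr_mono') (auto simp: p1_def)
        ultimately have "c * s n powr (- \<epsilon> / 2) \<le> c * min (t\<^sup>2 * s n powr (- (p1 + 2))) (s n powr (- p1))"
          using c(1) by simp
        moreover have "Re (h n t) \<le> - (c * min (t\<^sup>2 * s n powr (- (p1 + 2))) (s n powr (- p1)))"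
          using c(2)[of "s n" n t] elim t by (simp add: h_def b_def[abs_def])
        ultimately show "Re (h n t) \<le> - (c * s n powr (- \<epsilon> / 2))" by linarith
      qed
    qed
    have "((\<lambda>x. C3 / 6 * x powr (3 * \<epsilon> / 4)) \<longlongrightarrow> 0) (at_right 0)"
      using assms(2) by real_asymp
    then show "(\<lambda>n. C3 / 6 * s n powr (3 * \<epsilon> / 4)) \<longlonglongrightarrow> 0"
      using s_lim by (rule filterlim_compose)
    show "filterlim (\<lambda>n. B n * T n) at_top sequentially"
    proof (rule filterlim_at_top_mono)
      have "filterlim (\<lambda>x. sqrt c1 * x powr (- \<epsilon> / 4)) at_top (at_right 0)"
        using assms(2) c1(1) by real_asymp
      then show "filterlim (\<lambda>n. sqrt c1 * s n powr (- \<epsilon> / 4)) at_top sequentially"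
        using s_lim by (rule filterlim_compose)
      show "\<forall>\<^sub>F n in sequentially. sqrt c1 * s n powr (- \<epsilon> / 4) \<le> B n * T n"
        using B_ge s
      proof eventually_elim
        case (elim n)
        have "s n powr (- \<epsilon> / 4) = s n powr (- (p1 + 2) / 2) * T n"
          unfolding T_def by (simp add: p1_def field_simps flip: powr_add)
        also have "s n powr (- (p1 + 2) / 2) = sqrt (s n powr (- (p1 + 2)))"
          using elim by (intro powr_half_sqrt_powr) simp
        finally have "sqrt c1 * s n powr (- \<epsilon> / 4) = sqrt (c1 * s n powr (- (p1 + 2))) * T n"
          by (simp add: real_sqrt_mult)
        also have "\<dots> \<le> B n * T n"
          unfolding B_def using elim by (intro mult_right_mono real_sqrt_le_mono) (auto simp: T_def)
        finally show ?case .
      qed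
    qed
    show "(\<lambda>n. B n * exp (- (c * s n powr (- \<epsilon> / 2)))) \<longlonglongrightarrow> 0"
    proof (rule Lim_null_comparison)
      \<comment> \<open>The upper moment bound enters here: \<open>B n\<close> is at most a power of
        \<open>1 / s n\<close>, which the exponential of a negative multiple of a positive power of
        \<open>1 / s n\<close> beats.\<close>
      have "((\<lambda>x. sqrt (C2 * x powr (- (p + 2))) * exp (- (c * x powr (- \<epsilon> / 2)))) \<longlongrightarrow> 0) (at_right 0)"
        using assms(1,2) c(1) C2(1) by real_asymp
      then show "(\<lambda>n. sqrt (C2 * s n powr (- (p + 2))) * exp (- (c * s n powr (- \<epsilon> / 2)))) \<longlonglongrightarrow> 0"
        using s_lim by (rule filterlim_compose)
      show "\<forall>\<^sub>F n in sequentially. norm (B n * exp (- (c * s n powr (- \<epsilon> / 2))))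
          \<le> sqrt (C2 * s n powr (- (p + 2))) * exp (- (c * s n powr (- \<epsilon> / 2)))"
        using s
      proof eventually_elim
        case (elim n)
        have "B_sq a n \<le> C2 * s n powr (- (p + 2))"
          using C2(2)[of "s n" n] elim by (simp add: B_sq_def s_def)
        then show ?case using B_nonneg[of n] by (simp add: B_def abs_mult)
      qed
    qed
  qed
  \<comment> \<open>The coefficient is real, so only the real part of the complex limit is kept,
    normalised to 1.\<close>
  from tendsto_Re[OF tendsto_divide[OF this tendsto_const[of "of_real (sqrt (2 * pi))"]]]
  have lim: "(\<lambda>n. Re (of_real (B n) * integral {-pi..pi} (\<lambda>t. exp (h n t)) / of_real (sqrt (2 * pi)))) \<longlonglongrightarrow> 1"
    by (simp del: of_real_mult)
  show ?thesis
  proof (rule asymp_equivI', rule Lim_transform_eventually[OF lim])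
    show "\<forall>\<^sub>F n in sequentially. Re (of_real (B n) * integral {-pi..pi} (\<lambda>t. exp (h n t)) / of_real (sqrt (2 * pi)))
      = part_coeff a n / (1 / sqrt (2 * pi * B_sq a n) *
      exp (real n * saddle a n + (\<Sum>j=1..n. a j * exp (- real j * saddle a n))))"
    proof (intro always_eventually allI)
      fix n
      define E where "E = exp (real n * saddle a n + (\<Sum>j=1..n. a j * exp (- real j * saddle a n)))"
      define I where "I = integral {-pi..pi} (\<lambda>t. exp (h n t))"
      have "E > 0" by (simp add: E_def)
      have "of_real (part_coeff a n) = of_real (E / (2 * pi)) * I"
        using part_coeff_eq_integral[of a n "saddle a n"] by (simp add: E_def I_def h_def b_def[abs_def] s_def)
      then have part: "part_coeff a n = E / (2 * pi) * Re I"
        by (metis Re_complex_of_real times_complex.sel(1) Im_complex_of_real mult_zero_left diff_zero)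
      define r where "r = sqrt (2 * pi)"
      have r: "r > 0" "2 * pi = r * r" by (simp_all add: r_def)
      \<comment> \<open>Holds for every \<open>n\<close>: if \<open>B n = 0\<close>, as for
        \<open>n = 0\<close>, both sides are 0 by the convention for division by zero.\<close>
      have "part_coeff a n / (1 / (r * B n) * E) = B n * Re I / r"
        unfolding part r(2) using r(1) \<open>E > 0\<close> by (simp add: field_simps)
      moreover have "sqrt (2 * pi * B_sq a n) = r * B n" by (simp add: r_def B_def real_sqrt_mult)
      moreover have "Re (of_real (B n) * I / of_real r) = B n * Re I / r" by simp
      ultimately show "Re (of_real (B n) * I / of_real (sqrt (2 * pi)))
          = part_coeff a n / (1 / sqrt (2 * pi * B_sq a n) * E)"
        by (simp only: r_def)
    qed
  qed
qed

end
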